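(* Let $G=(\mathcal{V},\mathcal{E})$ be a connected, non-empty, finite undirected graph without isolated vertices, with $\mathcal{V}=\{1,\dots,N\}$, and let $v:\mathcal{V}\to(0,\infty)$ be a centrality function. Let $\lambda_1(G)$ be the normalized spectral gap and $h_v(G)$ the centrality-based Cheeger constant of $G$. Then $$\lambda_1(G)\le\left(2N\,\frac{v_+^2}{v_-}\right)h_v(G),$$ where $v_-=\min_{i\in\mathcal{V}}v(i)$ and $v_+=\max_{i\in\mathcal{V}}v(i)$.
   Context: Let $\mathbf{A}=[a_{ij}]$ be the adjacency matrix of $G$ ($a_{ij}=1$ if $(i,j)\in\mathcal{E}$, else $0$), $\mathbf{V}=\mathrm{diag}(v(1),\dots,v(N))$, and $\mathbf{M}_G=\mathbf{V}^{-1}\mathbf{A}$, which has real eigenvalues because it is self-adjoint for the inner product $\sum_i v(i)\varphi_1(i)\overline{\varphi_2(i)}$. The normalized spectral gap $\lambda_1(G)$ is the smallest non-zero eigenvalue of $\mathbf{I}-\mathbf{M}_G$. The centrality-based Cheeger constant is $$h_v(G)=\min\left\{\frac{|\partial U|}{|U|_v} : \emptyset\ne U\subset\mathcal{V},\ |U|_v\le\tfrac12|\mathcal{V}|_v\right\},$$ where $|\partial U|$ is the number of vertices that are not in $U$ but are connected by an edge to a vertex in $U$, and $|U|_v=\sum_{i\in U}v(i)$. *)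

theory Defs
  imports "Graph_Theory.Digraph_Component" "Jordan_Normal_Form.Char_Poly"
begin

text \<open>
  A finite undirected graph is a \<^locale>\<open>pair_pseudo_graph\<close>: a finite vertex set with a finite
  symmetric set of pairs of vertices as edges. Loops are neither required nor excluded;
  simple graphs are the special case \<^locale>\<open>pair_graph\<close>. An edge from a vertex to itself does not
  prevent that vertex from being isolated.
\<close>

definition isolated_vertex :: "'a pair_pre_digraph \<Rightarrow> 'a \<Rightarrow> bool" where
  "isolated_vertex G i \<longleftrightarrow> i \<in> pverts G \<and> \<not> (\<exists>j. j \<noteq> i \<and> (i, j) \<in> parcs G)"

text \<open>
  The matrices below are meant for graphs with vertex set \<open>{1..N}\<close>. Matrix indices start at \<open>0\<close>,
  so the vertex \<open>i + 1\<close> belongs to row and column \<open>i\<close>.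
\<close>

definition adjacency_mat :: "nat pair_pre_digraph \<Rightarrow> real mat" where
  "adjacency_mat G = mat (card (pverts G)) (card (pverts G))
     (\<lambda>(i, j). if (Suc i, Suc j) \<in> parcs G then 1 else 0)"

definition centrality_mat :: "nat pair_pre_digraph \<Rightarrow> (nat \<Rightarrow> real) \<Rightarrow> real mat" where
  "centrality_mat G v = mat_diag (card (pverts G)) (\<lambda>i. v (Suc i))"

definition centrality_mat_inv :: "nat pair_pre_digraph \<Rightarrow> (nat \<Rightarrow> real) \<Rightarrow> real mat" where
  "centrality_mat_inv G v = mat_diag (card (pverts G)) (\<lambda>i. inverse (v (Suc i)))"

lemma centrality_mat_inv:
  assumes "pverts G = {1..N}" and "\<And>i. i \<in> {1..N} \<Longrightarrow> v i > 0"
  shows "inverts_mat (centrality_mat G v) (centrality_mat_inv G v)"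
    and "inverts_mat (centrality_mat_inv G v) (centrality_mat G v)"
proof -
  have nz: "v (Suc i) \<noteq> 0" if "i < N" for i
    using assms(2)[of "Suc i"] that by auto
  show "inverts_mat (centrality_mat G v) (centrality_mat_inv G v)"
    unfolding inverts_mat_def centrality_mat_def centrality_mat_inv_def mat_diag_diag
    using nz assms(1) by (auto simp: mat_diag_def intro!: eq_matI)
  show "inverts_mat (centrality_mat_inv G v) (centrality_mat G v)"
    unfolding inverts_mat_def centrality_mat_def centrality_mat_inv_def mat_diag_diag
    using nz assms(1) by (auto simp: mat_diag_def intro!: eq_matI)
qed

definition normalized_adjacency_mat :: "nat pair_pre_digraph \<Rightarrow> (nat \<Rightarrow> real) \<Rightarrow> real mat" where
  "normalized_adjacency_mat G v = centrality_mat_inv G v * adjacency_mat G"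

text \<open>
  The matrix is self-adjoint for an inner product weighted by \<open>v\<close>, so all its complex eigenvalues
  are real, and it suffices to consider real eigenvalues of the real matrix. Eigenvalues may be
  negative; only the value \<open>0\<close> is excluded from the minimum.
\<close>

definition normalized_spectral_gap :: "nat pair_pre_digraph \<Rightarrow> (nat \<Rightarrow> real) \<Rightarrow> real" where
  "normalized_spectral_gap G v =
     Min {k. k \<noteq> 0 \<and> eigenvalue (1\<^sub>m (card (pverts G)) - normalized_adjacency_mat G v) k}"

definition vertex_boundary :: "'a pair_pre_digraph \<Rightarrow> 'a set \<Rightarrow> 'a set" where
  "vertex_boundary G U = {i \<in> pverts G. i \<notin> U \<and> (\<exists>j\<in>U. (i, j) \<in> parcs G)}"

definition cheeger_constant :: "'a pair_pre_digraph \<Rightarrow> ('a \<Rightarrow> real) \<Rightarrow> real" where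
  "cheeger_constant G v =
     Min {real (card (vertex_boundary G U)) / sum v U | U.
            U \<noteq> {} \<and> U \<subseteq> pverts G \<and> sum v U \<le> 1 / 2 * sum v (pverts G)}"

end

theory Submission
  imports Defs "HOL-Analysis.Function_Topology"
begin

text \<open>
  The two sides are separated by a constant. As \<open>G\<close> is connected, every admissible \<open>U\<close> has a
  boundary vertex, and \<open>|U|\<^sub>v \<le> N v\<^sub>+ / 2\<close>, so the right-hand side is at least
  \<open>4 v\<^sub>+ / v\<^sub>- \<ge> 4\<close>. On the other side, let \<open>r\<close> and \<open>k\<close> be the maximum and the minimum of the Rayleigh
  quotient of \<open>A\<close> with respect to \<open>V\<close>; both are eigenvalues of \<open>M\<^sub>G\<close>. As \<open>A\<close> has nonnegative entries,
  \<open>0 \<le> r\<close> and \<open>\<bar>k\<bar> \<le> r\<close>. If \<open>r \<noteq> 1\<close>, then \<open>1 - r \<le> 1\<close> is a nonzero eigenvalue of \<open>I - M\<^sub>G\<close>. If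
  \<open>r = 1\<close>, an edge between distinct vertices \<open>i\<close>, \<open>j\<close> makes the form differ at \<open>e\<^sub>i + e\<^sub>j\<close> and
  \<open>e\<^sub>i - e\<^sub>j\<close>, so \<open>k < 1\<close> and \<open>1 - k \<le> 2\<close> is a nonzero eigenvalue.
\<close>

section \<open>Quadratic forms and weighted norms on a finite index set\<close>

definition quad_form :: "'i set \<Rightarrow> ('i \<Rightarrow> 'i \<Rightarrow> real) \<Rightarrow> ('i \<Rightarrow> real) \<Rightarrow> real" where
  "quad_form I a x = (\<Sum>i\<in>I. \<Sum>j\<in>I. a i j * x i * x j)"

text \<open>The squared norm of the inner product for which \<open>V^-1 A\<close> is self-adjoint;
  \<open>quad_form\<close> divided by it is the Rayleigh quotient. Vectors are total functions of
  which only the values on \<open>I\<close> count.\<close>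

definition weighted_sq :: "'i set \<Rightarrow> ('i \<Rightarrow> real) \<Rightarrow> ('i \<Rightarrow> real) \<Rightarrow> real" where
  "weighted_sq I v x = (\<Sum>i\<in>I. v i * (x i)\<^sup>2)"

lemma quad_form_cong:
  assumes "\<And>i. i \<in> I \<Longrightarrow> x i = y i"
  shows "quad_form I a x = quad_form I a y"
  unfolding quad_form_def using assms by simp

lemma weighted_sq_cong:
  assumes "\<And>i. i \<in> I \<Longrightarrow> x i = y i"
  shows "weighted_sq I v x = weighted_sq I v y"
  unfolding weighted_sq_def using assms by simp

lemma quad_form_scale: "quad_form I a (\<lambda>i. c * x i) = c\<^sup>2 * quad_form I a x"
  by (simp add: quad_form_def sum_distrib_left power2_eq_square mult_ac)

lemma weighted_sq_scale: "weighted_sq I v (\<lambda>i. c * x i) = c\<^sup>2 * weighted_sq I v x"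
  by (simp add: weighted_sq_def sum_distrib_left power_mult_distrib mult_ac)

lemma quad_form_uminus_matrix: "quad_form I (\<lambda>i j. - a i j) x = - quad_form I a x"
  by (simp add: quad_form_def sum_negf)

lemma weighted_sq_nonneg:
  assumes "\<And>i. i \<in> I \<Longrightarrow> v i \<ge> 0"
  shows "weighted_sq I v x \<ge> 0"
  unfolding weighted_sq_def using assms by (simp add: sum_nonneg)

lemma weighted_sq_eq_0_iff:
  assumes "finite I" "\<And>i. i \<in> I \<Longrightarrow> v i > 0"
  shows "weighted_sq I v x = 0 \<longleftrightarrow> (\<forall>i\<in>I. x i = 0)"
proof -
  have "weighted_sq I v x = 0 \<longleftrightarrow> (\<forall>i\<in>I. v i * (x i)\<^sup>2 = 0)"
    unfolding weighted_sq_def using assms by (subst sum_nonneg_eq_0_iff) (auto simp: less_imp_le)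
  then show ?thesis using assms by fastforce
qed

text \<open>Symmetry merges the two cross terms into the factor 2. The expansion serves both for the
  variation at a maximizer and for evaluation at \<open>e_p + e_q\<close> and
  \<open>e_p - e_q\<close>.\<close>

lemma quad_form_add_unit:
  assumes I: "finite I" "k \<in> I" and sym: "\<And>i j. i \<in> I \<Longrightarrow> j \<in> I \<Longrightarrow> a i j = a j i"
  shows "quad_form I a (\<lambda>i. x i + (if i = k then t else 0))
           = quad_form I a x + 2 * t * (\<Sum>j\<in>I. a k j * x j) + t\<^sup>2 * a k k"
proof -
  let ?d = "\<lambda>i. if i = k then t else 0"
  have "quad_form I a (\<lambda>i. x i + ?d i)
      = quad_form I a x + (\<Sum>i\<in>I. \<Sum>j\<in>I. a i j * ?d i * x j)
        + (\<Sum>i\<in>I. \<Sum>j\<in>I. a i j * x i * ?d j) + (\<Sum>i\<in>I. \<Sum>j\<in>I. a i j * ?d i * ?d j)"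
    unfolding quad_form_def sum.distrib[symmetric]
    by (intro sum.cong refl) (simp add: algebra_simps)
  moreover have "(\<Sum>i\<in>I. \<Sum>j\<in>I. a i j * ?d i * x j) = t * (\<Sum>j\<in>I. a k j * x j)"
  proof -
    have "(\<Sum>i\<in>I. \<Sum>j\<in>I. a i j * ?d i * x j) = (\<Sum>i\<in>I. if i = k then t * (\<Sum>j\<in>I. a k j * x j) else 0)"
      by (intro sum.cong refl) (auto simp: sum_distrib_left mult_ac)
    then show ?thesis using I by simp
  qed
  moreover have "(\<Sum>i\<in>I. \<Sum>j\<in>I. a i j * x i * ?d j) = t * (\<Sum>j\<in>I. a k j * x j)"
  proof -
    have "(\<Sum>j\<in>I. a i j * x i * ?d j) = t * (a k i * x i)" if "i \<in> I" for i
    proof -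
      have "(\<Sum>j\<in>I. a i j * x i * ?d j) = (\<Sum>j\<in>I. if j = k then a i k * x i * t else 0)"
        by (intro sum.cong refl) auto
      then show ?thesis using I sym[OF that I(2)] by simp
    qed
    then show ?thesis by (simp add: sum_distrib_left)
  qed
  moreover have "(\<Sum>i\<in>I. \<Sum>j\<in>I. a i j * ?d i * ?d j) = t\<^sup>2 * a k k"
  proof -
    have "(\<Sum>j\<in>I. a i j * ?d i * ?d j) = (if i = k then t\<^sup>2 * a k k else 0)" if "i \<in> I" for i
    proof -
      have "(\<Sum>j\<in>I. a i j * ?d i * ?d j) = (\<Sum>j\<in>I. if j = k then a i k * ?d i * t else 0)"
        by (intro sum.cong refl) auto
      then show ?thesis using I by (simp add: power2_eq_square)
    qed
    then show ?thesis using I by simp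
  qed
  ultimately show ?thesis by simp
qed

lemma weighted_sq_add_unit:
  assumes I: "finite I" "k \<in> I"
  shows "weighted_sq I v (\<lambda>i. x i + (if i = k then t else 0))
           = weighted_sq I v x + 2 * t * (v k * x k) + t\<^sup>2 * v k"
proof -
  have "weighted_sq I v (\<lambda>i. x i + (if i = k then t else 0))
      = weighted_sq I v x + (\<Sum>i\<in>I. if i = k then 2 * t * (v k * x k) + t\<^sup>2 * v k else 0)"
    unfolding weighted_sq_def sum.distrib[symmetric]
    by (intro sum.cong refl) (auto simp: power2_eq_square algebra_simps)
  then show ?thesis using I by simp
qed

section \<open>Maximum of the Rayleigh quotient\<close>

text \<open>Tychonoff's theorem for the product topology of the function type. Coordinates outside
  \<open>I\<close> are pinned to \<open>c\<close>, since left free they could destroy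
  compactness.\<close>

lemma compact_PiE_UNIV:
  fixes S :: "'i \<Rightarrow> 'b::topological_space set"
  assumes "\<And>i. i \<in> I \<Longrightarrow> compact (S i)"
  shows "compact (Pi\<^sub>E UNIV (\<lambda>i. if i \<in> I then S i else {c}))"
proof -
  have "compactin (product_topology (\<lambda>i. euclidean) UNIV)
          (Pi\<^sub>E UNIV (\<lambda>i. if i \<in> I then S i else {c}))"
    using assms by (subst compactin_PiE) auto
  then show ?thesis by (simp add: euclidean_product_topology)
qed

text \<open>First-order condition without derivatives: for small \<open>t\<close> of the right sign
  a nonzero linear term beats the quadratic one.\<close>

lemma linear_coeff_zero:
  fixes g c :: real
  assumes "\<And>t. 2 * t * g \<le> t\<^sup>2 * c"
  shows "g = 0"
proof (rule ccontr)
  assume g: "g \<noteq> 0"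
  \<comment> \<open>At \<open>t = g / m\<close> the linear term is \<open>2 * g^2 / m\<close>, while
    \<open>c < m\<close> keeps the quadratic one at most \<open>g^2 / m\<close>. The
    \<open>+ 1\<close> makes \<open>m\<close> positive even for \<open>c = 0\<close>.\<close>
  define m where "m = \<bar>c\<bar> + 1"
  have m: "m > 0" "c < m" unfolding m_def by linarith+
  have "2 * (g / m) * g \<le> (g / m)\<^sup>2 * c" by (rule assms)
  also have "\<dots> \<le> (g / m)\<^sup>2 * m" using m by (intro mult_left_mono) auto
  also have "\<dots> = (g / m) * g" using m by (simp add: power2_eq_square)
  finally have "g\<^sup>2 / m \<le> 0" by (simp add: power2_eq_square)
  moreover have "g\<^sup>2 / m > 0" using g m by simp
  ultimately show False by simp
qed

lemma continuous_on_quad_form: "continuous_on S (quad_form I a)"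
  unfolding quad_form_def
  by (intro continuous_intros continuous_on_subset[OF continuous_on_product_coordinates]) auto

lemma continuous_on_weighted_sq: "continuous_on S (weighted_sq I v)"
  unfolding weighted_sq_def
  by (intro continuous_intros continuous_on_subset[OF continuous_on_product_coordinates]) auto

text \<open>The form attains its maximum \<open>r\<close> on the compact weighted unit sphere, and
  stationarity in each coordinate direction is the equation \<open>A x = r V x\<close>.\<close>

lemma weighted_rayleigh_max:
  fixes a :: "'i \<Rightarrow> 'i \<Rightarrow> real"
  assumes I: "finite I" "I \<noteq> {}" and sym: "\<And>i j. i \<in> I \<Longrightarrow> j \<in> I \<Longrightarrow> a i j = a j i"
    and pos: "\<And>i. i \<in> I \<Longrightarrow> v i > 0"
  obtains r x where "\<exists>i\<in>I. x i \<noteq> 0"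
    and "\<And>i. i \<in> I \<Longrightarrow> (\<Sum>j\<in>I. a i j * x j) = r * (v i * x i)"
    and "quad_form I a x = r * weighted_sq I v x"
    and "\<And>y. quad_form I a y \<le> r * weighted_sq I v y"
proof -
  \<comment> \<open>On the unit sphere \<open>v i * (x i)^2 <= 1\<close>, so this box contains every
    unit vector that vanishes outside \<open>I\<close>.\<close>
  define B where "B = Pi\<^sub>E UNIV (\<lambda>i. if i \<in> I then {- (1 / sqrt (v i))..1 / sqrt (v i)} else {0})"
  define K where "K = B \<inter> {x. weighted_sq I v x = 1}"
  have "compact B" unfolding B_def by (rule compact_PiE_UNIV) auto
  moreover have "closed {x. weighted_sq I v x = 1}"
    by (intro closed_Collect_eq continuous_on_weighted_sq continuous_on_const)
  ultimately have "compact K" unfolding K_def by (rule compact_Int_closed)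
  have normalize: "\<exists>z\<in>K. \<exists>c>0. c\<^sup>2 * weighted_sq I v y = 1 \<and> (\<forall>i\<in>I. z i = c * y i)"
    if y: "weighted_sq I v y > 0" for y
  proof -
    define c where "c = 1 / sqrt (weighted_sq I v y)"
    have c: "c > 0" "c\<^sup>2 * weighted_sq I v y = 1"
      using y by (auto simp: c_def power_divide)
    define z where "z = (\<lambda>i. if i \<in> I then c * y i else 0)"
    have z1: "weighted_sq I v z = 1"
      using weighted_sq_cong[of I z "\<lambda>i. c * y i" v] c by (simp add: z_def weighted_sq_scale)
    have "\<bar>z i\<bar> \<le> 1 / sqrt (v i)" if i: "i \<in> I" for i
    proof -
      have "v i * (z i)\<^sup>2 \<le> weighted_sq I v z"
        unfolding weighted_sq_def using I i pos
        by (intro member_le_sum[of i I "\<lambda>i. v i * (z i)\<^sup>2"]) (auto simp: less_imp_le)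
      then have "sqrt (v i * (z i)\<^sup>2) \<le> 1" by (simp add: z1)
      then show ?thesis using pos[OF i] by (simp add: real_sqrt_mult field_simps)
    qed
    then have "z \<in> B" unfolding B_def by (auto simp: abs_le_iff z_def PiE_def minus_le_iff)
    then have "z \<in> K" using z1 by (simp add: K_def)
    then show ?thesis using c by (intro bexI[of _ z] exI[of _ c]) (auto simp: z_def)
  qed
  have "weighted_sq I v (\<lambda>_. 1) > 0"
    unfolding weighted_sq_def using I pos by (simp add: sum_pos)
  then have "K \<noteq> {}" using normalize by blast
  then obtain x where x: "x \<in> K" "\<And>y. y \<in> K \<Longrightarrow> quad_form I a y \<le> quad_form I a x"
    using continuous_attains_sup[OF \<open>compact K\<close> _ continuous_on_quad_form] by metis
  define r where "r = quad_form I a x"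
  have wx: "weighted_sq I v x = 1" using x by (simp add: K_def)
  \<comment> \<open>Both sides are homogeneous of degree 2, so the bound on \<open>K\<close> extends
    to all \<open>y\<close> by rescaling.\<close>
  have le: "quad_form I a y \<le> r * weighted_sq I v y" for y
  proof (cases "weighted_sq I v y = 0")
    case True
    then have "\<forall>i\<in>I. y i = 0" using weighted_sq_eq_0_iff I pos by blast
    then have "quad_form I a y = 0" by (simp add: quad_form_def)
    then show ?thesis using True by simp
  next
    case False
    then have y: "weighted_sq I v y > 0"
      using weighted_sq_nonneg[of I v y] pos by (force simp: less_imp_le)
    then obtain z c where z: "z \<in> K" "c > 0" "c\<^sup>2 * weighted_sq I v y = 1" "\<forall>i\<in>I. z i = c * y i"
      using normalize by blast
    have "c\<^sup>2 * quad_form I a y = quad_form I a z"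
      using z quad_form_cong[of I z "\<lambda>i. c * y i" a] by (simp add: quad_form_scale)
    also have "\<dots> \<le> r" using x z by (simp add: r_def)
    also have "\<dots> = c\<^sup>2 * (r * weighted_sq I v y)" using z(3) by (simp add: mult_ac)
    finally show ?thesis using \<open>c > 0\<close> by simp
  qed
  have stationary: "(\<Sum>j\<in>I. a i j * x j) = r * (v i * x i)" if i: "i \<in> I" for i
  proof -
    \<comment> \<open>The global bound at \<open>x + t e_i\<close>: the terms free of
      \<open>t\<close> cancel because the form at \<open>x\<close> is \<open>r\<close> and its
      weighted norm is 1.\<close>
    have "2 * t * ((\<Sum>j\<in>I. a i j * x j) - r * (v i * x i)) \<le> t\<^sup>2 * (r * v i - a i i)" for t
      using le[of "\<lambda>j. x j + (if j = i then t else 0)"] I i sym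
      by (simp add: quad_form_add_unit weighted_sq_add_unit wx r_def[symmetric] algebra_simps)
    then have "(\<Sum>j\<in>I. a i j * x j) - r * (v i * x i) = 0" by (rule linear_coeff_zero)
    then show ?thesis by simp
  qed
  have "\<exists>i\<in>I. x i \<noteq> 0" using wx weighted_sq_eq_0_iff[of I v x] I pos by auto
  then show ?thesis
    by (rule that) (use stationary le wx in \<open>simp_all add: r_def\<close>)
qed

section \<open>An eigenvalue different from 1\<close>

text \<open>\<open>r \<noteq> 1\<close> keeps \<open>1 - r\<close> among the nonzero eigenvalues of
  \<open>I - M_G\<close>, and \<open>r >= -1\<close> bounds it by 2.\<close>

lemma exists_eigenvalue_neq_1:
  fixes a :: "'i \<Rightarrow> 'i \<Rightarrow> real"
  assumes I: "finite I" and sym: "\<And>i j. i \<in> I \<Longrightarrow> j \<in> I \<Longrightarrow> a i j = a j i"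
    and nonneg: "\<And>i j. i \<in> I \<Longrightarrow> j \<in> I \<Longrightarrow> a i j \<ge> 0"
    and pos: "\<And>i. i \<in> I \<Longrightarrow> v i > 0"
    and edge: "p \<in> I" "q \<in> I" "p \<noteq> q" "a p q > 0"
  obtains r x where "r \<noteq> 1" and "r \<ge> -1" and "\<exists>i\<in>I. x i \<noteq> 0"
    and "\<And>i. i \<in> I \<Longrightarrow> (\<Sum>j\<in>I. a i j * x j) = r * (v i * x i)"
proof -
  have ne: "I \<noteq> {}" using edge by auto
  obtain r x where x: "\<exists>i\<in>I. x i \<noteq> 0" "\<And>i. i \<in> I \<Longrightarrow> (\<Sum>j\<in>I. a i j * x j) = r * (v i * x i)"
    and upper: "\<And>y. quad_form I a y \<le> r * weighted_sq I v y"
    by (rule weighted_rayleigh_max[of I a v, OF I ne]) (use sym pos in blast)+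
  define e where "e = (\<lambda>i. if i = p then 1 else 0 :: real)"
  have qe: "quad_form I a e = a p p" "weighted_sq I v e = v p"
    using quad_form_add_unit[of I p a "\<lambda>_. 0" 1] weighted_sq_add_unit[of I p v "\<lambda>_. 0" 1] I edge sym
    by (simp_all add: e_def) (simp_all add: quad_form_def weighted_sq_def)
  have row: "(\<Sum>j\<in>I. a i j * e j) = a i p" for i
  proof -
    have "(\<Sum>j\<in>I. a i j * e j) = (\<Sum>j\<in>I. if j = p then a i p else 0)"
      by (intro sum.cong refl) (simp add: e_def)
    then show ?thesis using I edge by simp
  qed
  \<comment> \<open>The maximum is at least the quotient at the unit vector \<open>e_p\<close>,
    whose numerator is the diagonal entry \<open>a p p\<close>.\<close>
  have "0 \<le> r * v p" using upper[of e] nonneg[of p p] edge by (simp add: qe)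
  then have "r \<ge> 0" using pos[OF edge(1)] by (simp add: zero_le_mult_iff)
  show ?thesis
  proof (cases "r = 1")
    case False
    then show ?thesis using that[of r x] \<open>r \<ge> 0\<close> x by simp
  next
    case True
    \<comment> \<open>Maximizing the negated form minimizes the original one, so \<open>k\<close> is
      minus the smallest eigenvalue and \<open>- k\<close> is the value to return.\<close>
    define b where "b = (\<lambda>i j. - a i j)"
    have b_sym: "b i j = b j i" if "i \<in> I" "j \<in> I" for i j
      using sym[OF that] by (simp add: b_def)
    have qb: "quad_form I b y = - quad_form I a y" for y
      unfolding b_def by (rule quad_form_uminus_matrix)
    obtain k z where z: "\<exists>i\<in>I. z i \<noteq> 0"
      "\<And>i. i \<in> I \<Longrightarrow> (\<Sum>j\<in>I. b i j * z j) = k * (v i * z i)"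
      "quad_form I b z = k * weighted_sq I v z"
      and lower: "\<And>y. quad_form I b y \<le> k * weighted_sq I v y"
      by (rule weighted_rayleigh_max[of I b v, OF I ne]) (use b_sym pos in blast)+
    \<comment> \<open>Perron-type argument: as the entries are nonnegative, passing to absolute
      values gives a form value no smaller than the negated one. The weighted norm is unchanged, so
      \<open>k <= r = 1\<close>.\<close>
    have "k * weighted_sq I v z \<le> quad_form I a (\<lambda>i. \<bar>z i\<bar>)"
    proof -
      have "- quad_form I a z \<le> quad_form I a (\<lambda>i. \<bar>z i\<bar>)"
        unfolding quad_form_def sum_negf[symmetric]
      proof (intro sum_mono)
        fix i j assume "i \<in> I" "j \<in> I"
        then have "- (a i j * z i * z j) \<le> \<bar>a i j * z i * z j\<bar>" by linarith
        also have "\<dots> = a i j * \<bar>z i\<bar> * \<bar>z j\<bar>"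
          using nonneg \<open>i \<in> I\<close> \<open>j \<in> I\<close> by (simp add: abs_mult)
        finally show "- (a i j * z i * z j) \<le> a i j * \<bar>z i\<bar> * \<bar>z j\<bar>" .
      qed
      then show ?thesis using z(3) by (simp add: qb)
    qed
    also have "\<dots> \<le> weighted_sq I v z"
      using upper[of "\<lambda>i. \<bar>z i\<bar>"] True by (simp add: weighted_sq_def)
    finally have "(1 - k) * weighted_sq I v z \<ge> 0" by (simp add: algebra_simps)
    moreover have "weighted_sq I v z > 0"
      using weighted_sq_nonneg[of I v z] weighted_sq_eq_0_iff[of I v z] I pos z(1)
      by (metis less_eq_real_def)
    ultimately have "k \<le> 1" by (simp add: zero_le_mult_iff)
    \<comment> \<open>Otherwise maximum and minimum of the quotient are both 1 and the form equals
      the weighted norm everywhere. But \<open>e_p + e_q\<close> and \<open>e_p - e_q\<close> have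
      the same weighted norm, while their forms differ by \<open>4 * a q p\<close>.\<close>
    have "k \<noteq> -1"
    proof
      assume k: "k = -1"
      have ge: "quad_form I a y = weighted_sq I v y" for y
        using lower[of y] upper[of y] True k by (simp add: qb)
      have eq: "e q = 0" using edge(3) by (simp add: e_def)
      have q_add: "quad_form I a (\<lambda>i. e i + (if i = q then t else 0)) = a p p + 2 * t * a q p + t\<^sup>2 * a q q"
        for t
      proof -
        have "quad_form I a (\<lambda>i. e i + (if i = q then t else 0))
            = quad_form I a e + 2 * t * (\<Sum>j\<in>I. a q j * e j) + t\<^sup>2 * a q q"
          by (rule quad_form_add_unit) (use I edge sym in blast)+
        then show ?thesis by (simp add: qe row)
      qed
      have "quad_form I a (\<lambda>i. e i + (if i = q then 1 else 0)) = a p p + 2 * a q p + a q q"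
        using q_add[of 1] by simp
      moreover have "weighted_sq I v (\<lambda>i. e i + (if i = q then 1 else 0)) = v p + v q"
        using weighted_sq_add_unit[of I q v e 1] I edge(2) eq by (simp add: qe)
      moreover have "quad_form I a (\<lambda>i. e i + (if i = q then -1 else 0)) = a p p - 2 * a q p + a q q"
        using q_add[of "-1"] by simp
      moreover have "weighted_sq I v (\<lambda>i. e i + (if i = q then -1 else 0)) = v p + v q"
        using weighted_sq_add_unit[of I q v e "-1"] I edge(2) eq by (simp add: qe)
      ultimately have "a q p = 0" using ge by (smt (verit))
      then show False using edge(4) sym[OF edge(1,2)] by simp
    qed
    moreover have "(\<Sum>j\<in>I. a i j * z j) = - k * (v i * z i)" if "i \<in> I" for i
      using z(2)[OF that] by (simp add: b_def sum_negf)
    ultimately show ?thesis using that[of "- k" z] \<open>k \<le> 1\<close> z(1) by force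
  qed
qed

section \<open>Upper bound for the spectral gap\<close>

text \<open>Dividing row \<open>i\<close> of \<open>A x = r V x\<close> by \<open>v i\<close> turns
  \<open>x\<close> into an eigenvector of \<open>V^-1 A\<close>. Since vertex \<open>i + 1\<close>
  has matrix index \<open>i\<close>, the vector and the sums are shifted by
  \<open>Suc\<close>.\<close>

lemma eigenvalue_one_minus_normalized_adjacency:
  assumes verts: "pverts G = {1..N}" and pos: "\<And>i. i \<in> pverts G \<Longrightarrow> v i > 0"
    and ne: "\<exists>i\<in>{1..N}. x i \<noteq> 0"
    and eig: "\<And>i. i \<in> {1..N} \<Longrightarrow>
      (\<Sum>j\<in>{1..N}. (if (i, j) \<in> parcs G then 1 else 0) * x j) = r * (v i * x i)"
  shows "eigenvalue (1\<^sub>m (card (pverts G)) - normalized_adjacency_mat G v) (1 - r)"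
proof -
  define w where "w = vec N (\<lambda>i. x (Suc i))"
  have card: "card (pverts G) = N" by (simp add: verts)
  have M: "normalized_adjacency_mat G v
      = mat N N (\<lambda>(i, j). inverse (v (Suc i)) * (if (Suc i, Suc j) \<in> parcs G then 1 else 0))"
    unfolding normalized_adjacency_mat_def centrality_mat_inv_def adjacency_mat_def card
    by (subst mat_diag_mult_left[of _ N N]) auto
  have Mw: "normalized_adjacency_mat G v *\<^sub>v w = r \<cdot>\<^sub>v w"
  proof (rule eq_vecI)
    fix i assume "i < dim_vec (r \<cdot>\<^sub>v w)"
    then have i: "i < N" by (simp add: w_def)
    have "(normalized_adjacency_mat G v *\<^sub>v w) $ i
        = inverse (v (Suc i)) * (\<Sum>j = 0..<N. (if (Suc i, Suc j) \<in> parcs G then 1 else 0) * x (Suc j))"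
      using i by (simp add: M w_def scalar_prod_def sum_distrib_left mult.assoc)
    also have "(\<Sum>j = 0..<N. (if (Suc i, Suc j) \<in> parcs G then 1 else 0) * x (Suc j))
        = (\<Sum>j = 1..N. (if (Suc i, j) \<in> parcs G then 1 else 0) * x j)"
      by (rule sum.reindex_bij_witness[of _ "\<lambda>j. j - 1" Suc]) auto
    also have "\<dots> = r * (v (Suc i) * x (Suc i))" using i by (intro eig) auto
    finally show "(normalized_adjacency_mat G v *\<^sub>v w) $ i = (r \<cdot>\<^sub>v w) $ i"
      using i pos[of "Suc i"] by (simp add: verts w_def)
  qed (simp add: M w_def)
  have "(1\<^sub>m N - normalized_adjacency_mat G v) *\<^sub>v w = w - r \<cdot>\<^sub>v w"
    using minus_mult_distrib_mat_vec[of "1\<^sub>m N" N N "normalized_adjacency_mat G v" w] Mw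
    by (simp add: M w_def)
  also have "\<dots> = (1 - r) \<cdot>\<^sub>v w" by (rule eq_vecI) (auto simp: algebra_simps)
  finally have "(1\<^sub>m N - normalized_adjacency_mat G v) *\<^sub>v w = (1 - r) \<cdot>\<^sub>v w" .
  moreover have "w \<noteq> 0\<^sub>v N"
  proof
    assume w0: "w = 0\<^sub>v N"
    from ne obtain i where i: "i \<in> {1..N}" "x i \<noteq> 0" by blast
    then have "w $ (i - 1) = x i" by (auto simp: w_def)
    then show False using w0 i by auto
  qed
  ultimately show ?thesis
    unfolding eigenvalue_def eigenvector_def card by (intro exI[of _ w]) (simp add: M w_def)
qed

lemma finite_eigenvalues:
  assumes "(A :: 'a :: field mat) \<in> carrier_mat n n"
  shows "finite {k. eigenvalue A k}"
proof -
  have "char_poly A \<noteq> 0" using degree_monic_char_poly[OF assms] by auto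
  then show ?thesis using poly_roots_finite by (simp add: eigenvalue_root_char_poly[OF assms])
qed

lemma normalized_spectral_gap_le:
  assumes "k \<noteq> 0" and "eigenvalue (1\<^sub>m (card (pverts G)) - normalized_adjacency_mat G v) k"
  shows "normalized_spectral_gap G v \<le> k"
proof -
  have "1\<^sub>m (card (pverts G)) - normalized_adjacency_mat G v
      \<in> carrier_mat (card (pverts G)) (card (pverts G))"
    unfolding normalized_adjacency_mat_def centrality_mat_inv_def adjacency_mat_def
    by (auto simp: mat_diag_def)
  \<comment> \<open>Finiteness is what makes \<open>Min\<close> a lower bound of the set.\<close>
  then have "finite {k. k \<noteq> 0 \<and> eigenvalue (1\<^sub>m (card (pverts G)) - normalized_adjacency_mat G v) k}"
    by (rule finite_subset[rotated, OF finite_eigenvalues]) auto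
  then show ?thesis unfolding normalized_spectral_gap_def using assms by (intro Min_le) auto
qed

lemma normalized_spectral_gap_le_2:
  assumes graph: "pair_pseudo_graph G" and verts: "pverts G = {1..N}"
    and pos: "\<And>i. i \<in> pverts G \<Longrightarrow> v i > 0"
    and edge: "(p, q) \<in> parcs G" "p \<noteq> q"
  shows "normalized_spectral_gap G v \<le> 2"
proof -
  interpret pair_pseudo_graph G by (rule graph)
  define a where "a = (\<lambda>i j. if (i, j) \<in> parcs G then 1 else 0 :: real)"
  have sym: "a i j = a j i" for i j unfolding a_def using arcs_symmetric by auto
  have pos': "v i > 0" if "i \<in> {1..N}" for i using pos that verts by blast
  have nonneg: "a i j \<ge> 0" for i j by (simp add: a_def)
  have pq: "p \<in> {1..N}" "q \<in> {1..N}" "a p q > 0"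
    using edge verts in_arcsD1 in_arcsD2 by (blast, blast, simp add: a_def)
  obtain r x where r: "r \<noteq> 1" "r \<ge> -1" "\<exists>i\<in>{1..N}. x i \<noteq> 0"
    "\<And>i. i \<in> {1..N} \<Longrightarrow> (\<Sum>j\<in>{1..N}. a i j * x j) = r * (v i * x i)"
    by (rule exists_eigenvalue_neq_1[of "{1..N}" a v p q,
          OF finite_atLeastAtMost sym nonneg pos' pq(1,2) edge(2) pq(3)]) blast+
  have "eigenvalue (1\<^sub>m (card (pverts G)) - normalized_adjacency_mat G v) (1 - r)"
    using eigenvalue_one_minus_normalized_adjacency[OF verts pos r(3)] r(4) by (simp add: a_def)
  then have "normalized_spectral_gap G v \<le> 1 - r"
    using r(1) by (intro normalized_spectral_gap_le) auto
  then show ?thesis using r(2) by simp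
qed

section \<open>Lower bound for the Cheeger constant\<close>

text \<open>Without boundary vertices, \<open>U\<close> is closed under following edges, so a path
  from \<open>U\<close> to a vertex outside can never leave it.\<close>

lemma vertex_boundary_nonempty:
  assumes graph: "pair_pseudo_graph G" and connected: "Digraph_Component.connected (with_proj G)"
    and U: "U \<noteq> {}" "U \<subset> pverts G"
  shows "vertex_boundary G U \<noteq> {}"
proof
  interpret pair_pseudo_graph G by (rule graph)
  assume empty: "vertex_boundary G U = {}"
  obtain u w where uw: "u \<in> U" "w \<in> pverts G" "w \<notin> U" using U by blast
  then have "(u, w) \<in> rtrancl_on (pverts G) ((parcs G)\<^sup>s)"
    using connected U by (auto simp: connected_conv)
  then have "w \<in> U"
  proof (induction rule: rtrancl_on_induct)
    case base
    then show ?case using uw by simp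
  next
    case (step y z)
    \<comment> \<open>The boundary is defined by arcs from the outer vertex into \<open>U\<close>,
      hence the reversed orientation.\<close>
    then have "(z, y) \<in> parcs G" using arcs_symmetric by (auto simp: symcl_def)
    then show ?case using step empty by (auto simp: vertex_boundary_def)
  qed
  then show False using uw by simp
qed

text \<open>Each admissible \<open>U\<close> has at least one boundary vertex and at most half of
  the total weight. The two distinct vertices ensure that an admissible set exists.\<close>

lemma cheeger_constant_ge:
  assumes fin: "finite (pverts G)" and pos: "\<And>i. i \<in> pverts G \<Longrightarrow> v i > 0"
    and bdry: "\<And>U. U \<noteq> {} \<Longrightarrow> U \<subset> pverts G \<Longrightarrow> vertex_boundary G U \<noteq> {}"
    and two: "p \<in> pverts G" "q \<in> pverts G" "p \<noteq> q"
  shows "cheeger_constant G v \<ge> 2 / sum v (pverts G)"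
proof -
  let ?S = "sum v (pverts G)"
  let ?adm = "\<lambda>U. U \<noteq> {} \<and> U \<subseteq> pverts G \<and> sum v U \<le> 1 / 2 * ?S"
  let ?R = "{real (card (vertex_boundary G U)) / sum v U | U. ?adm U}"
  have S: "?S > 0" using fin pos two by (intro sum_pos) auto
  have "finite ?R"
    by (rule finite_subset[of _ "(\<lambda>U. real (card (vertex_boundary G U)) / sum v U) ` Pow (pverts G)"])
       (use fin in auto)
  moreover have "?R \<noteq> {}"
  proof -
    \<comment> \<open>The lighter of the two vertices carries at most half of the total weight, so
      its singleton is admissible and \<open>Min\<close> ranges over a nonempty set.\<close>
    have "v p + v q = sum v {p, q}" using two by simp
    also have "\<dots> \<le> ?S" using two fin pos by (intro sum_mono2) (auto simp: less_imp_le)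
    finally have "v p \<le> 1 / 2 * ?S \<or> v q \<le> 1 / 2 * ?S" by linarith
    then have "?adm {p} \<or> ?adm {q}" using two by simp
    then show ?thesis by blast
  qed
  moreover have "2 / ?S \<le> real (card (vertex_boundary G U)) / sum v U" if U: "?adm U" for U
  proof -
    \<comment> \<open>The full vertex set is too heavy, as its weight is positive and exceeds its
      own half.\<close>
    have "U \<noteq> pverts G" using U S by auto
    then have "vertex_boundary G U \<noteq> {}" using U bdry by blast
    moreover have "finite (vertex_boundary G U)" using fin by (simp add: vertex_boundary_def)
    ultimately have "card (vertex_boundary G U) \<ge> 1" by (simp add: Suc_leI card_gt_0_iff)
    moreover have "sum v U > 0" using U fin pos by (intro sum_pos) (auto intro: finite_subset)
    moreover have "2 / ?S \<le> 1 / sum v U" using U S \<open>sum v U > 0\<close> by (simp add: field_simps)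
    ultimately show ?thesis by (smt (verit) divide_right_mono of_nat_1 of_nat_mono)
  qed
  ultimately show ?thesis unfolding cheeger_constant_def by (subst Min_ge_iff) auto
qed

section \<open>Comparison of the spectral gap with the Cheeger constant\<close>

theorem proposition3p4:
  fixes G :: "nat pair_pre_digraph" and N :: nat and v :: "nat \<Rightarrow> real"
  assumes graph: "pair_pseudo_graph G"
    and verts: "pverts G = {1..N}"
    and nonempty: "pverts G \<noteq> {}"
    and connected: "Digraph_Component.connected (with_proj G)"
    and no_isolated: "\<And>i. \<not> isolated_vertex G i"
    and pos: "\<And>i. i \<in> pverts G \<Longrightarrow> v i > 0"
  shows "normalized_spectral_gap G v
           \<le> (2 * real N * ((Max (v ` pverts G))\<^sup>2 / Min (v ` pverts G))) * cheeger_constant G v"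
proof -
  interpret pair_pseudo_graph G by (rule graph)
  obtain p where p: "p \<in> pverts G" using nonempty by blast
  then obtain q where q: "p \<noteq> q" "(p, q) \<in> parcs G"
    using no_isolated[of p] unfolding isolated_vertex_def by metis
  then have qV: "q \<in> pverts G" using in_arcsD2 by blast
  let ?M = "Max (v ` pverts G)" and ?m = "Min (v ` pverts G)" and ?S = "sum v (pverts G)"
  have fin: "finite (pverts G)" by (simp add: verts)
  have m: "?m > 0" using fin nonempty pos by (subst Min_gr_iff) auto
  have mM: "?m \<le> ?M" using fin nonempty by (meson Max_ge Min_le finite_imageI image_eqI order_trans p)
  have "?S \<le> (\<Sum>i\<in>pverts G. ?M)" using fin by (intro sum_mono) auto
  then have SM: "?S \<le> real N * ?M" by (simp add: verts)
  have S: "?S > 0" using fin nonempty pos by (intro sum_pos) auto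
  have N: "real N > 0" using p by (simp add: verts)
  \<comment> \<open>The bound 2 is relaxed to 4 because \<open>2 * N * (M^2 / m)\<close> times
    \<open>2 / (N * M)\<close> is \<open>4 * M / m\<close>, which is at least 4.\<close>
  have "normalized_spectral_gap G v \<le> 4"
    using normalized_spectral_gap_le_2[OF graph verts _ q(2,1), of v] pos by simp
  also have "\<dots> \<le> 4 * (?M / ?m)" using m mM by (simp add: pos_le_divide_eq)
  also have "\<dots> = 2 * real N * (?M\<^sup>2 / ?m) * (2 / (real N * ?M))"
    using m mM N by (simp add: field_simps power2_eq_square)
  also have "\<dots> \<le> 2 * real N * (?M\<^sup>2 / ?m) * (2 / ?S)"
    using SM S m N mM by (intro mult_left_mono divide_left_mono) auto
  also have "\<dots> \<le> 2 * real N * (?M\<^sup>2 / ?m) * cheeger_constant G v"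
    using m cheeger_constant_ge[OF fin pos vertex_boundary_nonempty[OF graph connected] p qV q(1)]
    by (intro mult_left_mono) auto
  finally show ?thesis .
qed

end
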